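(* For any integer $d\ge2$, there is a convex function $f\colon\mathbb{R}^d\to\mathbb{R}$ that is not in the closed convex hull $\overline{\operatorname{conv} F}$ (the closure being taken with respect to the topology of pointwise convergence) of the set $F$ of all functions of the form $g\circ p_v$, where $g\colon\mathbb{R}\to\mathbb{R}$ is a convex function and $v\in\mathbb{R}^d$.
   Context: For $v\in\mathbb{R}^d$, $p_v\colon\mathbb{R}^d\to\mathbb{R}$ is the linear map $p_v(x):=v\cdot x$, where $\cdot$ is the dot product. The set $F$ is regarded as a subset of the vector space of all functions $\mathbb{R}^d\to\mathbb{R}$, with the topology of pointwise convergence (the product topology); $\overline{\operatorname{conv} F}$ is the closure in this topology of the convex hull of $F$. *)

theory Defs
  imports "HOL-Analysis.Analysis" "HOL-Library.Function_Algebras"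
begin

text \<open>The library gives \<open>'a \<Rightarrow> 'b\<close> its pointwise additive structure (\<open>Function_Algebras\<close>) and the
  product topology (\<open>Function_Topology\<close>, fact \<open>open_fun_def\<close>).  Pointwise scalar multiplication
  is added here, so that \<^const>\<open>hull\<close> with \<^const>\<open>convex\<close> applies to sets of functions.\<close>

instantiation "fun" :: (type, real_vector) real_vector
begin

definition scaleR_fun :: "real \<Rightarrow> ('a \<Rightarrow> 'b) \<Rightarrow> 'a \<Rightarrow> 'b"
  where "scaleR_fun c f = (\<lambda>x. c *\<^sub>R f x)"

instance
  by standard (simp_all add: scaleR_fun_def fun_eq_iff scaleR_add_right scaleR_add_left)

end

lemma scaleR_fun_apply [simp]: "(c *\<^sub>R f) x = c *\<^sub>R f x"
  by (simp add: scaleR_fun_def)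

definition dot_map :: "real ^ 'n \<Rightarrow> real ^ 'n \<Rightarrow> real"
  where "dot_map v x = v \<bullet> x"

definition convex_ridge_functions :: "(real ^ 'n \<Rightarrow> real) set"
  where "convex_ridge_functions = {g \<circ> dot_map v | g v. convex_on UNIV g}"

end

theory Submission
  imports Defs
begin

text \<open>The obstruction is Popoviciu's inequality: every convex \<open>g\<close> on the real line satisfies
  \<open>2 (g ((x+y)/2) + g ((y+z)/2) + g ((z+x)/2)) \<le> g x + g y + g z + 3 g ((x+y+z)/3)\<close>.
  A linear map carries midpoints to midpoints and centroids to centroids, so for any three points
  of \<open>\<real>\<^sup>n\<close> the same inequality holds for every ridge function (\<open>popoviciu_ridge\<close>).
  It is preserved by convex combinations and by pointwise limits, since it is a linear inequality
  between finitely many values of the function, and therefore holds on the whole closed convex hull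
  (\<open>popoviciu_closed_convex_hull\<close>).

  Convex functions of two variables need not satisfy it. The function \<open>max 0 (max s t)\<close> has
  kinks along three rays that leave the origin, not along full lines. For a triangle with one vertex
  on each ray and centroid at the origin, the function is affine on each edge, so it has
  the same total over the edge midpoints as over the vertices. The right-hand side then gains
  nothing from the centroid, where the function vanishes, while the left-hand side counts the
  positive total over the midpoints twice.\<close>

text \<open>Among points \<open>u\<close>, \<open>v\<close> of \<open>[m, z]\<close> with a prescribed sum, the chord over
  \<open>[m, z]\<close> bounds \<open>g u + g v\<close> by a quantity depending only on that sum. The sum here is
  the one arising from the two midpoints that lie on the same side of the centroid.\<close>

lemma convex_two_point_chord_bound:
  fixes g :: "real \<Rightarrow> real"
  assumes g: "convex_on UNIV g"
    and u: "m \<le> u" "u \<le> z" and v: "m \<le> v" "v \<le> z"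
    and sum: "2 * (u + v) = 3 * m + z"
  shows "2 * (g u + g v) \<le> 3 * g m + g z"
proof (cases "m = z")
  case True
  with u v show ?thesis by simp
next
  case False
  with u have mz: "m < z" by simp
  define s t where "s = (u - m) / (z - m)" and "t = (v - m) / (z - m)"
  have chord: "g w \<le> (1 - r) * g m + r * g z"
    if "m \<le> w" "w \<le> z" and r: "r = (w - m) / (z - m)" for w r
  proof -
    have "0 \<le> r" "r \<le> 1" unfolding r using that(1,2) mz by (simp_all add: divide_simps)
    moreover have "(1 - r) *\<^sub>R m + r *\<^sub>R z = w"
    proof -
      have "r * (z - m) = w - m" using r mz by simp
      then show ?thesis by (simp add: algebra_simps)
    qed
    ultimately show ?thesis using convex_onD[OF g, of r m z] by simp
  qed
  have st: "s + t = 1 / 2"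
  proof -
    have "s + t = (u - m + (v - m)) / (z - m)"
      unfolding s_def t_def by (rule add_divide_distrib[symmetric])
    also have "u - m + (v - m) = (z - m) / 2" using sum by simp
    finally show ?thesis using mz by simp
  qed
  have "g u + g v \<le> (2 - (s + t)) * g m + (s + t) * g z"
    using chord[OF u s_def] chord[OF v t_def] by (simp add: algebra_simps)
  then show ?thesis unfolding st by simp
qed

text \<open>If the middle value \<open>y\<close> is at most the centroid \<open>m\<close>, then the midpoints
  involving \<open>z\<close> both lie in \<open>[m, z]\<close> and are controlled by the chord there, and the
  remaining midpoint is controlled by \<open>x\<close> and \<open>y\<close>.\<close>

lemma popoviciu_middle_below_centroid:
  fixes g :: "real \<Rightarrow> real"
  assumes g: "convex_on UNIV g" and "x \<le> y" "y \<le> z" and "y \<le> (x + y + z) / 3"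
  shows "2 * (g ((x + y) / 2) + g ((y + z) / 2) + g ((z + x) / 2))
         \<le> g x + g y + g z + 3 * g ((x + y + z) / 3)"
proof -
  have "2 * (g ((y + z) / 2) + g ((z + x) / 2)) \<le> 3 * g ((x + y + z) / 3) + g z"
    using assms(2-) by (intro convex_two_point_chord_bound[OF g]) (auto simp: field_simps)
  moreover have "2 * g ((x + y) / 2) \<le> g x + g y"
    using convex_onD[OF g, of "1/2" x y] by (simp add: add_divide_distrib)
  ultimately show ?thesis by simp
qed

lemma popoviciu_sorted:
  fixes g :: "real \<Rightarrow> real"
  assumes g: "convex_on UNIV g" and le: "x \<le> y" "y \<le> z"
  shows "2 * (g ((x + y) / 2) + g ((y + z) / 2) + g ((z + x) / 2))
         \<le> g x + g y + g z + 3 * g ((x + y + z) / 3)"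
proof (cases "y \<le> (x + y + z) / 3")
  case True
  then show ?thesis using popoviciu_middle_below_centroid[OF g le] by simp
next
  case False
  \<comment> \<open>Reflecting the line reverses the order and brings the middle value below the centroid.\<close>
  define h where "h w = g (- w)" for w
  have h: "convex_on UNIV h"
  proof (rule convex_onI)
    fix t a b :: real
    assume "0 < t" "t < 1"
    then show "h ((1 - t) *\<^sub>R a + t *\<^sub>R b) \<le> (1 - t) * h a + t * h b"
      using convex_onD[OF g, of t "- a" "- b"] by (simp add: h_def algebra_simps)
  qed simp
  have neg: "(- a - b) / 2 = - ((a + b) / 2)" "(- a - b - c) / 3 = - ((a + b + c) / 3)"
    for a b c :: real
    by (simp_all add: field_simps)
  have "2 * (h ((- z + - y) / 2) + h ((- y + - x) / 2) + h ((- x + - z) / 2))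
        \<le> h (- z) + h (- y) + h (- x) + 3 * h ((- z + - y + - x) / 3)"
    using False le by (intro popoviciu_middle_below_centroid[OF h]) (auto simp: field_simps)
  then show ?thesis by (simp add: h_def neg add.commute add.left_commute)
qed

theorem popoviciu_inequality:
  fixes g :: "real \<Rightarrow> real"
  assumes g: "convex_on UNIV g"
  shows "2 * (g ((x + y) / 2) + g ((y + z) / 2) + g ((z + x) / 2))
         \<le> g x + g y + g z + 3 * g ((x + y + z) / 3)"
proof -
  consider "x \<le> y \<and> y \<le> z" | "x \<le> z \<and> z \<le> y" | "y \<le> x \<and> x \<le> z" | "y \<le> z \<and> z \<le> x"
    | "z \<le> x \<and> x \<le> y" | "z \<le> y \<and> y \<le> x"
    by linarith
  then show ?thesis
    by cases (auto simp: add.commute add.left_commute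
        dest: popoviciu_sorted[OF g, of x y z] popoviciu_sorted[OF g, of x z y]
          popoviciu_sorted[OF g, of y x z] popoviciu_sorted[OF g, of y z x]
          popoviciu_sorted[OF g, of z x y] popoviciu_sorted[OF g, of z y x])
qed

definition popoviciu_functions ::
  "'a::real_vector \<Rightarrow> 'a \<Rightarrow> 'a \<Rightarrow> ('a \<Rightarrow> real) set"
  where "popoviciu_functions a b c =
    {h. 2 * (h ((1/2) *\<^sub>R (a + b)) + h ((1/2) *\<^sub>R (b + c)) + h ((1/2) *\<^sub>R (c + a)))
        \<le> h a + h b + h c + 3 * h ((1/3) *\<^sub>R (a + b + c))}"

lemma popoviciu_ridge:
  fixes a b c :: "real ^ 'n"
  shows "convex_ridge_functions \<subseteq> popoviciu_functions a b c"
proof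
  fix h :: "real ^ 'n \<Rightarrow> real"
  assume "h \<in> convex_ridge_functions"
  then obtain g v where h: "h = g \<circ> dot_map v" and g: "convex_on UNIV g"
    unfolding convex_ridge_functions_def by blast
  show "h \<in> popoviciu_functions a b c"
    using popoviciu_inequality[OF g, of "v \<bullet> a" "v \<bullet> b" "v \<bullet> c"]
    by (simp add: popoviciu_functions_def h dot_map_def inner_add_right)
qed

lemma convex_popoviciu_functions: "convex (popoviciu_functions a b c)"
proof (rule convexI)
  fix h k :: "'a \<Rightarrow> real" and s t :: real
  assume h: "h \<in> popoviciu_functions a b c" and k: "k \<in> popoviciu_functions a b c"
    and s: "0 \<le> s" and t: "0 \<le> t"
  show "s *\<^sub>R h + t *\<^sub>R k \<in> popoviciu_functions a b c"
    using add_mono[OF mult_left_mono[OF h[unfolded popoviciu_functions_def mem_Collect_eq] s]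
        mult_left_mono[OF k[unfolded popoviciu_functions_def mem_Collect_eq] t]]
    by (simp add: popoviciu_functions_def algebra_simps)
qed

lemma closed_popoviciu_functions: "closed (popoviciu_functions a b c)"
  unfolding popoviciu_functions_def
  by (intro closed_Collect_le continuous_intros continuous_on_product_coordinates)

lemma popoviciu_closed_convex_hull:
  "closure (convex hull convex_ridge_functions) \<subseteq> popoviciu_functions a b c"
  by (intro closure_minimal hull_minimal popoviciu_ridge convex_popoviciu_functions
      closed_popoviciu_functions)

theorem corollary3:
  assumes "CARD('n::finite) \<ge> 2"
  shows "\<exists>f :: real ^ 'n \<Rightarrow> real.
           convex_on UNIV f \<and> f \<notin> closure (convex hull convex_ridge_functions)"
proof -
  have "\<not> is_singleton (UNIV :: 'n set)"
    using assms by (simp add: is_singleton_altdef)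
  then obtain i j :: 'n where ij: "i \<noteq> j"
    by (metis UNIV_I is_singletonI' empty_iff)
  define f :: "real ^ 'n \<Rightarrow> real" where "f x = max 0 (max (x $ i) (x $ j))" for x
  have "convex_on UNIV f"
  proof (rule convex_onI)
    fix t :: real and x y :: "real ^ 'n"
    assume t: "0 < t" "t < 1"
    have bound: "(1 - t) * p + t * q \<le> (1 - t) * f x + t * f y"
      if "p \<le> f x" "q \<le> f y" for p q
      using t that by (intro add_mono mult_left_mono) auto
    have "0 \<le> (1 - t) * f x + t * f y"
      "(1 - t) * x $ i + t * y $ i \<le> (1 - t) * f x + t * f y"
      "(1 - t) * x $ j + t * y $ j \<le> (1 - t) * f x + t * f y"
      using bound[of 0 0] bound[of "x $ i" "y $ i"] bound[of "x $ j" "y $ j"]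
      by (simp_all add: f_def)
    then show "f ((1 - t) *\<^sub>R x + t *\<^sub>R y) \<le> (1 - t) * f x + t * f y"
      by (simp add: f_def[of "_ + _"])
  qed simp
  moreover
  \<comment> \<open>In the plane of coordinates \<open>i\<close> and \<open>j\<close>, one vertex on each kink ray, scaled so that the centroid is the origin. The values
    of \<open>f\<close> are \<open>1, 0, 0\<close> at the vertices, \<open>1/2, 0, 1/2\<close> at the midpoints and \<open>0\<close> at the
    centroid, which turns the inequality into \<open>2 \<le> 1\<close>.\<close>
  have "f \<notin> popoviciu_functions (axis i 1 + axis j 1) (- axis i 1) (- axis j 1)"
    using ij by (simp add: popoviciu_functions_def f_def axis_def)
  ultimately show ?thesis
    using popoviciu_closed_convex_hull by blast
qed

end
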